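(* Let $\mathbb{T}$ be a time scale, let $\beta,\gamma\in\mathbb{T}$ with $\beta<\gamma$, let $\alpha\in[0,1]$, and let $\psi,\phi:[\beta,\gamma]_{\mathbb{T}}\to\mathbb{R}$ be continuous and Diamond-Alpha integrable with $\phi>0$. If $\psi/\phi$ is increasing (respectively, decreasing) and $\phi$ is increasing (respectively, decreasing) on $[\beta,\gamma]_{\mathbb{T}}$, then the function $$s\mapsto \frac{\int_{\beta}^s \psi(\upsilon)\,\Diamond_\alpha\upsilon}{\int_{\beta}^s \phi(\upsilon)\,\Diamond_\alpha\upsilon}$$ is increasing (respectively, decreasing) for $s\in[\beta,\gamma]_{\mathbb{T}}$, $s>\beta$.
   Context: A time scale $\mathbb{T}$ is a nonempty closed subset of $\mathbb{R}$, and $[\beta,\gamma]_{\mathbb{T}}=[\beta,\gamma]\cap\mathbb{T}$. The Delta integral $\int_a^b f\,\Delta\upsilon$ ($a\le b$ in $\mathbb{T}$) is the integral of $f$ over $[a,b)\cap\mathbb{T}$ with respect to the Delta measure, determined by $\mu_\Delta([c,d)\cap\mathbb{T})=d-c$ for $c\le d$ in $\mathbb{T}$; the Nabla integral $\int_a^b f\,\nabla\upsilon$ is the integral of $f$ over $(a,b]\cap\mathbb{T}$ with respect to the Nabla measure, determined by $\mu_\nabla((c,d]\cap\mathbb{T})=d-c$ for $c\le d$ in $\mathbb{T}$. The Diamond-Alpha integral is $$\int_a^b f(\upsilon)\,\Diamond_\alpha\upsilon=\alpha\int_a^b f(\upsilon)\,\Delta\upsilon+(1-\alpha)\int_a^b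 f(\upsilon)\,\nabla\upsilon .$$ "Increasing" and "decreasing" are meant in the non-strict sense. *)

theory Defs
  imports "HOL-Analysis.Analysis"
begin

definition time_scale :: "real set \<Rightarrow> bool" where
  "time_scale T \<longleftrightarrow> T \<noteq> {} \<and> closed T"

text \<open>
  The Delta and Nabla measures are the measures on \<open>T\<close> determined by the length of the half-open
  time scale intervals; the generated \<open>\<sigma>\<close>-algebra is the Borel \<open>\<sigma>\<close>-algebra of \<open>T\<close>. The prescribed
  values leave open the mass of \<open>{Max T}\<close> for the Delta measure and of \<open>{Min T}\<close> for the
  Nabla measure (if these points exist), but the domains of integration below never contain them.
  The lemmas \<open>emeasure_delta_measure\<close> and \<open>emeasure_nabla_measure\<close> show that the extensions exist.
\<close>

definition delta_measure :: "real set \<Rightarrow> real measure" where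
  "delta_measure T =
     extend_measure T {(c, d). c \<in> T \<and> d \<in> T \<and> c \<le> d}
       (\<lambda>(c, d). {c..<d} \<inter> T) (\<lambda>(c, d). ennreal (d - c))"

definition nabla_measure :: "real set \<Rightarrow> real measure" where
  "nabla_measure T =
     extend_measure T {(c, d). c \<in> T \<and> d \<in> T \<and> c \<le> d}
       (\<lambda>(c, d). {c<..d} \<inter> T) (\<lambda>(c, d). ennreal (d - c))"

definition delta_integral :: "real set \<Rightarrow> real \<Rightarrow> real \<Rightarrow> (real \<Rightarrow> real) \<Rightarrow> real" where
  "delta_integral T a b f = (LINT x:{a..<b} \<inter> T|delta_measure T. f x)"

definition nabla_integral :: "real set \<Rightarrow> real \<Rightarrow> real \<Rightarrow> (real \<Rightarrow> real) \<Rightarrow> real" where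
  "nabla_integral T a b f = (LINT x:{a<..b} \<inter> T|nabla_measure T. f x)"

definition diamond_integrable :: "real set \<Rightarrow> real \<Rightarrow> real \<Rightarrow> (real \<Rightarrow> real) \<Rightarrow> bool" where
  "diamond_integrable T a b f \<longleftrightarrow>
     set_integrable (delta_measure T) ({a..<b} \<inter> T) f \<and>
     set_integrable (nabla_measure T) ({a<..b} \<inter> T) f"

definition diamond_integral :: "real set \<Rightarrow> real \<Rightarrow> real \<Rightarrow> real \<Rightarrow> (real \<Rightarrow> real) \<Rightarrow> real" where
  "diamond_integral T \<alpha> a b f = \<alpha> * delta_integral T a b f + (1 - \<alpha>) * nabla_integral T a b f"

lemma emeasure_extend_measure_preimage:
  fixes G :: "real \<Rightarrow> real \<Rightarrow> real set" and p :: "real \<Rightarrow> real"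
  assumes M: "M = extend_measure T {(c, d). c \<in> T \<and> d \<in> T \<and> c \<le> d}
       (\<lambda>(c, d). G c d) (\<lambda>(c, d). ennreal (d - c))"
    and G: "\<And>c d. G c d \<subseteq> T" and p: "p \<in> S \<rightarrow> T"
    and pre: "\<And>c d. c \<in> T \<Longrightarrow> d \<in> T \<Longrightarrow> c \<le> d \<Longrightarrow>
       p -` G c d \<inter> S \<in> sets borel \<and> emeasure lborel (p -` G c d \<inter> S) = ennreal (d - c)"
    and S: "S \<in> sets borel" and cd: "c \<in> T" "d \<in> T" "c \<le> d"
  shows "emeasure M (G c d) = ennreal (d - c)"
proof -
  let ?I = "{(c, d). c \<in> T \<and> d \<in> T \<and> c \<le> d}"
  let ?L = "restrict_space lborel S"
  define N where "N = distr ?L M p"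
  have sub: "(\<lambda>(c, d). G c d) ` ?I \<subseteq> Pow T"
    using G by auto
  have sM: "sets M = sigma_sets T ((\<lambda>(c, d). G c d) ` ?I)"
    unfolding M by (rule sets_extend_measure[OF sub])
  have pm: "p \<in> measurable ?L M"
  proof (rule measurable_sigma_sets[OF sM sub])
    show "p \<in> space ?L \<rightarrow> T"
      using p by (simp add: space_restrict_space)
    fix A assume "A \<in> (\<lambda>(c, d). G c d) ` ?I"
    then show "p -` A \<inter> space ?L \<in> sets ?L"
      using pre S by (auto simp: space_restrict_space sets_restrict_space_iff)
  qed
  have eN: "emeasure N (G a b) = ennreal (b - a)" if "a \<in> T" "b \<in> T" "a \<le> b" for a b
  proof -
    have "G a b \<in> sets M"
      unfolding sM using that by (intro sigma_sets.Basic) auto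
    then have "emeasure N (G a b) = emeasure ?L (p -` G a b \<inter> space ?L)"
      unfolding N_def by (rule emeasure_distr[OF pm])
    also have "\<dots> = emeasure lborel (p -` G a b \<inter> S)"
      using S by (simp add: space_restrict_space emeasure_restrict_space)
    finally show ?thesis using pre[OF that] by simp
  qed
  have "sets N = sets M" by (simp add: N_def)
  then have "positive (sets M) (emeasure N)" "countably_additive (sets M) (emeasure N)"
    using emeasure_positive[of N] emeasure_countably_additive[of N] by simp_all
  then show ?thesis
    by (intro emeasure_extend_measure_Pair[OF M, where \<mu>' = "emeasure N"]) (use eN G cd in auto)
qed

lemma emeasure_delta_measure:
  assumes T: "closed T" and cd: "c \<in> T" "d \<in> T" "c \<le> d"
  shows "emeasure (delta_measure T) ({c..<d} \<inter> T) = ennreal (d - c)"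
proof -
  define S where "S = (\<Union>t\<in>T. {t<..}) \<union> (if \<exists>m\<in>T. \<forall>t\<in>T. m \<le> t then {Inf T} else {})"
  define p where "p x = Sup (T \<inter> {..x})" for x
  have Sge: "x \<in> S \<longleftrightarrow> (\<exists>t\<in>T. t \<le> x)" for x
  proof -
    have Inf: "Inf T = m" if "m \<in> T" "\<forall>t\<in>T. m \<le> t" for m
      using that by (intro cInf_eq_minimum) auto
    show ?thesis
    proof (cases "\<exists>t\<in>T. t < x")
      case True
      then show ?thesis by (auto simp: S_def intro: less_imp_le)
    next
      case False
      then have "x \<in> T" if "t \<in> T" "t \<le> x" for t
        using that by (metis order_less_le)
      then show ?thesis
        using False Inf unfolding S_def by (auto simp: not_less; metis order_refl)
    qed
  qed
  have "(\<Union>t\<in>T. {t<..}) \<in> sets borel"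
    by (intro borel_open) auto
  then have S: "S \<in> sets borel"
    unfolding S_def by (intro sets.Un) auto
  have pT: "p x \<in> T \<and> p x \<le> x \<and> (\<forall>t\<in>T. t \<le> x \<longrightarrow> t \<le> p x)" if "x \<in> S" for x
  proof -
    have ne: "T \<inter> {..x} \<noteq> {}" and bd: "bdd_above (T \<inter> {..x})"
      using that Sge by auto
    have "p x \<in> T \<inter> {..x}"
      unfolding p_def using T by (intro closed_contains_Sup ne bd) auto
    then show ?thesis
      unfolding p_def using cSup_upper[OF _ bd] by auto
  qed
  have pre: "p -` ({a..<b} \<inter> T) \<inter> S = {a..<b}" if "a \<in> T" "b \<in> T" "a \<le> b" for a b
    using that pT Sge by (auto; force)
  show ?thesis
    by (rule emeasure_extend_measure_preimage[OF delta_measure_def, where p = p and S = S])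
       (use pre pT S cd in auto)
qed

lemma emeasure_nabla_measure:
  assumes T: "closed T" and cd: "c \<in> T" "d \<in> T" "c \<le> d"
  shows "emeasure (nabla_measure T) ({c<..d} \<inter> T) = ennreal (d - c)"
proof -
  define S where "S = (\<Union>t\<in>T. {..<t}) \<union> (if \<exists>m\<in>T. \<forall>t\<in>T. t \<le> m then {Sup T} else {})"
  define p where "p x = Inf (T \<inter> {x..})" for x
  have Sge: "x \<in> S \<longleftrightarrow> (\<exists>t\<in>T. x \<le> t)" for x
  proof -
    have Sup: "Sup T = m" if "m \<in> T" "\<forall>t\<in>T. t \<le> m" for m
      using that by (intro cSup_eq_maximum) auto
    show ?thesis
    proof (cases "\<exists>t\<in>T. x < t")
      case True
      then show ?thesis by (auto simp: S_def intro: less_imp_le)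
    next
      case False
      then have "x \<in> T" if "t \<in> T" "x \<le> t" for t
        using that by (metis order_less_le)
      then show ?thesis
        using False Sup unfolding S_def by (auto simp: not_less; metis order_refl)
    qed
  qed
  have "(\<Union>t\<in>T. {..<t}) \<in> sets borel"
    by (intro borel_open) auto
  then have S: "S \<in> sets borel"
    unfolding S_def by (intro sets.Un) auto
  have pT: "p x \<in> T \<and> x \<le> p x \<and> (\<forall>t\<in>T. x \<le> t \<longrightarrow> p x \<le> t)" if "x \<in> S" for x
  proof -
    have ne: "T \<inter> {x..} \<noteq> {}" and bd: "bdd_below (T \<inter> {x..})"
      using that Sge by auto
    have "p x \<in> T \<inter> {x..}"
      unfolding p_def using T by (intro closed_contains_Inf ne bd) auto
    then show ?thesis
      unfolding p_def using cInf_lower[OF _ bd] by auto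
  qed
  have pre: "p -` ({a<..b} \<inter> T) \<inter> S = {a<..b}" if "a \<in> T" "b \<in> T" "a \<le> b" for a b
    using that pT Sge by (auto; force)
  show ?thesis
    by (rule emeasure_extend_measure_preimage[OF nabla_measure_def, where p = p and S = S])
       (use pre pT S cd in auto)
qed

end

theory Submission
  imports Defs
begin

text \<open>
  For \<open>\<beta> < s < t\<close>, all points that contribute to the integrals over \<open>[\<beta>, s]\<close> lie to the left of \<open>s\<close>
  and all points that contribute to the integrals over \<open>[s, t]\<close> lie to the right of it. With
  \<open>r = \<psi> s / \<phi> s\<close>, monotonicity of \<open>\<psi> / \<phi>\<close> thus gives \<open>\<psi> \<le> r \<phi>\<close> on the first interval and
  \<open>r \<phi> \<le> \<psi>\<close> on the second one, so the quotient of the integrals over \<open>[\<beta>, s]\<close> is at most \<open>r\<close>, and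
  the one over \<open>[s, t]\<close> is at least \<open>r\<close>. The quotient over \<open>[\<beta>, t]\<close> is the mediant of the two. The
  decreasing case follows by passing to \<open>-\<psi>\<close>.
\<close>

text \<open>The generators of the \<sigma>-algebra are exactly such sets with
  \<open>c \<le> d\<close>, and for \<open>d < c\<close> the set is empty. Integrability can thus be
  restricted to subintervals with endpoints in \<open>T\<close>.\<close>

lemma delta_interval_sets:
  assumes "c \<in> T" "d \<in> T"
  shows "{c..<d} \<inter> T \<in> sets (delta_measure T)"
proof (cases "c \<le> d")
  case True
  have "sets (delta_measure T) =
      sigma_sets T ((\<lambda>(c, d). {c..<d} \<inter> T) ` {(c, d). c \<in> T \<and> d \<in> T \<and> c \<le> d})"
    unfolding delta_measure_def by (rule sets_extend_measure) auto
  then show ?thesis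
    using assms True by (auto intro!: sigma_sets.Basic)
qed auto

lemma nabla_interval_sets:
  assumes "c \<in> T" "d \<in> T"
  shows "{c<..d} \<inter> T \<in> sets (nabla_measure T)"
proof (cases "c \<le> d")
  case True
  have "sets (nabla_measure T) =
      sigma_sets T ((\<lambda>(c, d). {c<..d} \<inter> T) ` {(c, d). c \<in> T \<and> d \<in> T \<and> c \<le> d})"
    unfolding nabla_measure_def by (rule sets_extend_measure) auto
  then show ?thesis
    using assms True by (auto intro!: sigma_sets.Basic)
qed auto

text \<open>A nonnegative integrand with integral 0 vanishes almost everywhere; as \<open>f\<close>
  is positive on \<open>A\<close>, this would make \<open>A\<close> a null set.\<close>

lemma set_integral_pos:
  fixes f :: "'a \<Rightarrow> real"
  assumes f: "set_integrable M A f" and A: "A \<in> sets M" "emeasure M A \<noteq> 0"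
    and pos: "\<And>x. x \<in> A \<Longrightarrow> 0 < f x"
  shows "0 < (LINT x:A|M. f x)"
proof -
  let ?g = "\<lambda>x. indicator A x *\<^sub>R f x"
  have nonneg: "0 \<le> ?g x" for x
    using pos[of x] by (cases "x \<in> A") auto
  have "integral\<^sup>L M ?g \<noteq> 0"
  proof
    assume "integral\<^sup>L M ?g = 0"
    then have "AE x in M. ?g x = 0"
      using f nonneg by (subst (asm) integral_nonneg_eq_0_iff_AE) (auto simp: set_integrable_def)
    then have "AE x in M. x \<notin> A"
      by eventually_elim (use pos in \<open>force simp: indicator_def split: if_splits\<close>)
    then show False
      using A AE_iff_null_sets[OF A(1)] by auto
  qed
  moreover have "0 \<le> integral\<^sup>L M ?g"
    using nonneg by simp
  ultimately show ?thesis
    unfolding set_lebesgue_integral_def by simp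
qed

lemma diamond_integrable_subinterval:
  assumes "diamond_integrable T a d f" "b \<in> T" "c \<in> T" "a \<le> b" "c \<le> d"
  shows "diamond_integrable T b c f"
  using assms unfolding diamond_integrable_def
  by (auto intro: set_integrable_subset delta_interval_sets nabla_interval_sets)

lemma diamond_integrable_cmult:
  "diamond_integrable T a b f \<Longrightarrow> diamond_integrable T a b (\<lambda>x. k * f x)"
  unfolding diamond_integrable_def by auto

lemma diamond_integral_cmult:
  "diamond_integral T \<alpha> a b (\<lambda>x. k * f x) = k * diamond_integral T \<alpha> a b f"
  unfolding diamond_integral_def delta_integral_def nabla_integral_def
  by (simp add: algebra_simps)

text \<open>The half-open domains keep the two pieces disjoint: \<open>b\<close> can lie only in the
  right piece for Delta and only in the left one for Nabla.\<close>

lemma diamond_integral_combine: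
  assumes f: "diamond_integrable T a c f" and T: "a \<in> T" "b \<in> T" "c \<in> T" and le: "a \<le> b" "b \<le> c"
  shows "diamond_integral T \<alpha> a c f = diamond_integral T \<alpha> a b f + diamond_integral T \<alpha> b c f"
proof -
  have int: "diamond_integrable T a b f" "diamond_integrable T b c f"
    using diamond_integrable_subinterval[OF f] T le by auto
  have "{a..<c} \<inter> T = ({a..<b} \<inter> T) \<union> ({b..<c} \<inter> T)" "{a<..c} \<inter> T = ({a<..b} \<inter> T) \<union> ({b<..c} \<inter> T)"
    using le by auto
  moreover have "({a..<b} \<inter> T) \<inter> ({b..<c} \<inter> T) = {}" "({a<..b} \<inter> T) \<inter> ({b<..c} \<inter> T) = {}"
    by auto
  ultimately have "delta_integral T a c f = delta_integral T a b f + delta_integral T b c f"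
    "nabla_integral T a c f = nabla_integral T a b f + nabla_integral T b c f"
    using int unfolding delta_integral_def nabla_integral_def diamond_integrable_def
    by (simp_all add: set_integral_Un)
  then show ?thesis
    unfolding diamond_integral_def by (simp add: algebra_simps)
qed

lemma diamond_integral_mono:
  assumes "diamond_integrable T a b f" "diamond_integrable T a b g" "\<alpha> \<in> {0..1}"
    and "\<And>x. x \<in> {a..b} \<inter> T \<Longrightarrow> f x \<le> g x"
  shows "diamond_integral T \<alpha> a b f \<le> diamond_integral T \<alpha> a b g"
  using assms
  unfolding diamond_integral_def delta_integral_def nabla_integral_def diamond_integrable_def
  by (intro add_mono mult_left_mono set_integral_mono) auto

text \<open>Both domains have measure \<open>b - a > 0\<close>, so the Delta and the Nabla integral
  are positive, and their weights are nonnegative and not both 0.\<close>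

lemma diamond_integral_pos:
  assumes T: "closed T" "a \<in> T" "b \<in> T" "a < b" and \<alpha>: "\<alpha> \<in> {0..1}"
    and f: "diamond_integrable T a b f" and pos: "\<And>x. x \<in> {a..b} \<inter> T \<Longrightarrow> 0 < f x"
  shows "0 < diamond_integral T \<alpha> a b f"
proof -
  have "0 < delta_integral T a b f"
    unfolding delta_integral_def using f T pos
    by (intro set_integral_pos delta_interval_sets)
       (auto simp: diamond_integrable_def emeasure_delta_measure)
  moreover have "0 < nabla_integral T a b f"
    unfolding nabla_integral_def using f T pos
    by (intro set_integral_pos nabla_interval_sets)
       (auto simp: diamond_integrable_def emeasure_nabla_measure)
  ultimately show ?thesis
    using \<alpha> unfolding diamond_integral_def
    by (cases "\<alpha> = 0") (auto intro: add_pos_nonneg)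
qed

text \<open>\<psi> may take either sign here, so that -\<psi> can replace it in the decreasing
  case.\<close>

lemma mono_on_diamond_integral_quotient:
  assumes T: "closed T" "\<beta> \<in> T" and \<alpha>: "\<alpha> \<in> {0..1}"
    and int: "diamond_integrable T \<beta> \<gamma> \<psi>" "diamond_integrable T \<beta> \<gamma> \<phi>"
    and pos: "\<And>x. x \<in> {\<beta>..\<gamma>} \<inter> T \<Longrightarrow> \<phi> x > 0"
    and mono: "mono_on ({\<beta>..\<gamma>} \<inter> T) (\<lambda>x. \<psi> x / \<phi> x)"
  shows "mono_on ({\<beta><..\<gamma>} \<inter> T)
    (\<lambda>s. diamond_integral T \<alpha> \<beta> s \<psi> / diamond_integral T \<alpha> \<beta> s \<phi>)"
proof (rule mono_onI)
  let ?I = "diamond_integral T \<alpha>"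
  fix s t assume st: "s \<in> {\<beta><..\<gamma>} \<inter> T" "t \<in> {\<beta><..\<gamma>} \<inter> T" "s \<le> t"
  define r where "r = \<psi> s / \<phi> s"
  have sub: "diamond_integrable T a b \<psi> \<and> diamond_integrable T a b \<phi>"
    if "a \<in> T" "b \<in> T" "\<beta> \<le> a" "b \<le> \<gamma>" for a b
    using int that by (blast intro: diamond_integrable_subinterval)
  have "?I \<beta> s \<psi> \<le> ?I \<beta> s (\<lambda>x. r * \<phi> x)"
  proof (rule diamond_integral_mono)
    fix x assume x: "x \<in> {\<beta>..s} \<inter> T"
    then have "\<psi> x / \<phi> x \<le> r"
      unfolding r_def using st by (intro mono_onD[OF mono]) auto
    then show "\<psi> x \<le> r * \<phi> x"
      using pos[of x] x st by (simp add: field_simps)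
  qed (use sub T st \<alpha> in \<open>auto intro: diamond_integrable_cmult\<close>)
  then have le: "?I \<beta> s \<psi> \<le> r * ?I \<beta> s \<phi>"
    by (simp add: diamond_integral_cmult)
  have "?I s t (\<lambda>x. r * \<phi> x) \<le> ?I s t \<psi>"
  proof (rule diamond_integral_mono)
    fix x assume x: "x \<in> {s..t} \<inter> T"
    then have "r \<le> \<psi> x / \<phi> x"
      unfolding r_def using st by (intro mono_onD[OF mono]) auto
    then show "r * \<phi> x \<le> \<psi> x"
      using pos[of x] x st by (simp add: field_simps)
  qed (use sub T st \<alpha> in \<open>auto intro: diamond_integrable_cmult\<close>)
  then have ge: "r * ?I s t \<phi> \<le> ?I s t \<psi>"
    by (simp add: diamond_integral_cmult)
  have pos': "0 < ?I \<beta> u \<phi>" if "u \<in> {s, t}" for u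
    using that st T \<alpha> sub pos by (intro diamond_integral_pos) auto
  have split: "?I \<beta> t f = ?I \<beta> s f + ?I s t f" if "f \<in> {\<psi>, \<phi>}" for f
    using that st T sub by (intro diamond_integral_combine) auto
  \<comment> \<open>Strict positivity fails for \<open>s = t\<close>. The lower bound 0 is written
    as \<open>0 * \<phi> x\<close> so that the scaling lemmas apply.\<close>
  have nonneg: "0 \<le> ?I s t \<phi>"
  proof -
    have "?I s t (\<lambda>x. 0 * \<phi> x) \<le> ?I s t \<phi>"
      using sub[of s t] st \<alpha> pos
      by (intro diamond_integral_mono diamond_integrable_cmult) (auto intro: less_imp_le)
    then show ?thesis
      by (subst (asm) diamond_integral_cmult) simp
  qed
  \<comment> \<open>The quotients over [\<beta>, s] and [s, t] are compared through \<open>r\<close>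
    in cross-multiplied form, since the second denominator may be 0.\<close>
  have "?I \<beta> s \<psi> * ?I s t \<phi> \<le> r * ?I \<beta> s \<phi> * ?I s t \<phi>"
    using le nonneg by (rule mult_right_mono)
  also have "\<dots> = r * ?I s t \<phi> * ?I \<beta> s \<phi>"
    by simp
  also have "\<dots> \<le> ?I s t \<psi> * ?I \<beta> s \<phi>"
    using ge pos'[of s] by (intro mult_right_mono) auto
  \<comment> \<open>After cross-multiplying and splitting at \<open>s\<close>, the product of the
    two integrals over [\<beta>, s] cancels, which leaves the inequality just shown.\<close>
  finally show "?I \<beta> s \<psi> / ?I \<beta> s \<phi> \<le> ?I \<beta> t \<psi> / ?I \<beta> t \<phi>"
    using pos'[of s] pos'[of t] split by (simp add: divide_simps) (simp add: algebra_simps)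
qed

theorem theorem2p7:
  fixes T :: "real set" and \<beta> \<gamma> \<alpha> :: real and \<psi> \<phi> :: "real \<Rightarrow> real"
  assumes "time_scale T"
    and "\<beta> \<in> T" and "\<gamma> \<in> T" and "\<beta> < \<gamma>"
    and "\<alpha> \<in> {0..1}"
    and "continuous_on ({\<beta>..\<gamma>} \<inter> T) \<psi>" and "continuous_on ({\<beta>..\<gamma>} \<inter> T) \<phi>"
    and "diamond_integrable T \<beta> \<gamma> \<psi>" and "diamond_integrable T \<beta> \<gamma> \<phi>"
    and "\<And>x. x \<in> {\<beta>..\<gamma>} \<inter> T \<Longrightarrow> \<phi> x > 0"
  shows "(mono_on ({\<beta>..\<gamma>} \<inter> T) (\<lambda>x. \<psi> x / \<phi> x) \<and> mono_on ({\<beta>..\<gamma>} \<inter> T) \<phi> \<longrightarrow>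
           mono_on ({\<beta><..\<gamma>} \<inter> T)
             (\<lambda>s. diamond_integral T \<alpha> \<beta> s \<psi> / diamond_integral T \<alpha> \<beta> s \<phi>)) \<and>
         (antimono_on ({\<beta>..\<gamma>} \<inter> T) (\<lambda>x. \<psi> x / \<phi> x) \<and> antimono_on ({\<beta>..\<gamma>} \<inter> T) \<phi> \<longrightarrow>
           antimono_on ({\<beta><..\<gamma>} \<inter> T)
             (\<lambda>s. diamond_integral T \<alpha> \<beta> s \<psi> / diamond_integral T \<alpha> \<beta> s \<phi>))"
proof (intro conjI impI; elim conjE)
  have T: "closed T"
    using assms(1) by (simp add: time_scale_def)
  \<comment> \<open>The open slot is for the integrability of \<psi> or -\<psi>. Resolving with
    positivity leaves a trivial membership premise, which is the \<open>_\<close> skipped in the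
    uses below.\<close>
  note rule = mono_on_diamond_integral_quotient[OF T assms(2,5) _ assms(9,10)]
  show "mono_on ({\<beta><..\<gamma>} \<inter> T)
      (\<lambda>s. diamond_integral T \<alpha> \<beta> s \<psi> / diamond_integral T \<alpha> \<beta> s \<phi>)"
    if "mono_on ({\<beta>..\<gamma>} \<inter> T) (\<lambda>x. \<psi> x / \<phi> x)"
    using rule[OF assms(8) _ that] by simp
  assume "antimono_on ({\<beta>..\<gamma>} \<inter> T) (\<lambda>x. \<psi> x / \<phi> x)"
  \<comment> \<open>The sign is written as a factor \<open>- 1\<close> so that
    \<open>diamond_integral_cmult\<close> can pull it out of the integral again.\<close>
  then have "mono_on ({\<beta>..\<gamma>} \<inter> T) (\<lambda>x. (- 1 * \<psi> x) / \<phi> x)"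
    by (simp add: monotone_on_def)
  from rule[OF diamond_integrable_cmult[OF assms(8)] _ this]
  show "antimono_on ({\<beta><..\<gamma>} \<inter> T)
      (\<lambda>s. diamond_integral T \<alpha> \<beta> s \<psi> / diamond_integral T \<alpha> \<beta> s \<phi>)"
    unfolding diamond_integral_cmult by (simp add: monotone_on_def)
qed

end
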